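(* Fix an integer $b\ge 1$. For every integer $h\ge 1$, the set of stacks of $h$ words over $\Sigma_b$ that are accepted by the automaton $\mathcal{A}_b$ (defined in the context) is in bijection with the set of polyominoes inscribed in a rectangle of size $b\times h$.
   Context: A polyomino is a finite nonempty set of cells of the square lattice that is edge-connected. A polyomino is inscribed in a $b\times h$ rectangle if it is contained in that rectangle and has at least one cell in each of the four extreme rows/columns (top, bottom, leftmost, rightmost) of the rectangle. Such a polyomino can be encoded as a stack of $h$ rows, each row being a word $u=u_1\cdots u_b\in\{0,1\}^b$ with $u_i=1$ iff the $i$-th cell of that row is selected. Write $|u|_1$ for the number of $1$'s in $u$, and for a word $w$ and a letter $a$ let $\mathrm{pos}_a(w)=\{i: w_i=a\}$. Let $m=\lceil b/2\rceil$. States. Let $\mathcal{T}_b$ be the set of triples $(w,l,r)$ with $w=w_1\cdots w_b\in\{0,1,\dots,m\}^b$ and $l,r\in\{\mathrm{True},\mathrm{False}\}$ satisfying: (Empty row) if $w=0^b$ then $l=r=\mathrm{False}$; (Inscription) if $w_1\ne0$ then $l=\mathrm{True}$, and if $w_b\neq 0$ then $r=\mathrm{True}$; (Separation) if $w_i\neq0$ then $w_{i-1},w_{i+1}\in\{0,w_i\}$ (whenever these indices exist); (Non-crossing) for positions $i<k<j<l'$ in $\{1,\dots,b\}$, if $w_i=w_j\neq 0$ and $w_k=w_{l'}\ne 0$ then $w_i=w_k$. Two words $w,w'$ are equivalent if $\mathrm{pos}_0(w)=\mathrm{pos}_0(w')$ and there is a permutation $\sigma$ of $\{1,\dots,m\}$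 with $\mathrm{pos}_i(w)=\mathrm{pos}_{\sigma(i)}(w')$ for all $i\in\{1,\dots,m\}$; $[w]$ denotes the lexicographically minimal word in the class of $w$. The automaton $\mathcal{A}_b=(\Sigma_b,Q_b,q_{0},F_b,\delta_b)$ has alphabet $\Sigma_b=\{u\in\{0,1\}^b: |u|_1>0\}$, states $Q_b=\{([w],l,r): (w,l,r)\in\mathcal{T}_b\}$, initial state $q_0=(0^b,\mathrm{False},\mathrm{False})$, and accepting states $F_b=\{([w],l,r)\in Q_b: w\in\{0,1\}^b,\ l=r=\mathrm{True}\}$ (a single component, touching both sides). Transitions. $\delta_b(([w],l,r),u)$ is defined only if for every letter $a\ne 0$ with $\mathrm{pos}_a(w)\neq\emptyset$ we have $\mathrm{pos}_a(w)\cap\mathrm{pos}_1(u)\neq\emptyset$. Then $\delta_b(([w],l,r),u)=([w'],l',r')$ computed as follows. (Vertical step) Reading $u$ left to right, build $x$: if $u_i=0$ then $x_i=0$; if $u_i=1$ and $w_i\neq0$ then $x_i=w_i$; if $u_i=1$ and $w_i=0$ then $x_i=N+1$ with $N=\max\{w_1,\dots,w_b,x_1,\dots,x_{i-1}\}$. (Horizontal step) The horizontally connected components of $x$ are its maximal factors containing no $0$. Two such components are directly linked if they share a letter; let "linked" be the transitive closure of this relation, and group components into linked classes. Assign letters $1,2,\dots$ to the classes in increasing order, each time to the not-yet-labelled class containing the leftmost component among the unlabelled classes. Then $w'$ is obtained from $x$ by replacing every letter of every component by the letter of its class (zeros stay zeros). (Adjacency) $l'=l\vee(u_1=1)$ and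 $r'=r\vee(u_b=1)$. A stack of $h$ words $u^{(1)},\dots,u^{(h)}\in\Sigma_b$ (read from top to bottom) is accepted by $\mathcal{A}_b$ if starting from $q_0$ the successive transitions $\delta_b(\cdot,u^{(1)}),\dots,\delta_b(\cdot,u^{(h)})$ are all defined and the final state lies in $F_b$. *)

theory Defs
  imports Complex_Main "HOL-Library.List_Lexorder" "HOL-Combinatorics.Permutations"
begin

text \<open>
  Cells of the square lattice are pairs (column, row) of integers, with rows numbered from top to
  bottom. Columns, rows and positions in words are counted from 0, so that the letter
  \<open>w\<^sub>i\<close> of a word is \<open>w ! (i - 1)\<close>.
\<close>

type_synonym cell = "int \<times> int"
type_synonym word = "nat list"
type_synonym state = "word \<times> bool \<times> bool"

section \<open>Polyominoes\<close>

definition adjacent :: "cell \<Rightarrow> cell \<Rightarrow> bool" where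
  "adjacent p q \<longleftrightarrow> \<bar>fst p - fst q\<bar> + \<bar>snd p - snd q\<bar> = 1"

definition edge_connected :: "cell set \<Rightarrow> bool" where
  "edge_connected P \<longleftrightarrow>
     (\<forall>p\<in>P. \<forall>q\<in>P. (p, q) \<in> {(c, d). c \<in> P \<and> d \<in> P \<and> adjacent c d}\<^sup>*)"

definition polyomino :: "cell set \<Rightarrow> bool" where
  "polyomino P \<longleftrightarrow> finite P \<and> P \<noteq> {} \<and> edge_connected P"

text \<open>
  Polyominoes are taken up to translation: each one inscribed in a rectangle of size
  \<open>b \<times> h\<close> is represented by its unique translate inscribed in the rectangle whose top left cell
  is \<open>(0, 0)\<close>.
\<close>

definition inscribed_polyominoes :: "nat \<Rightarrow> nat \<Rightarrow> cell set set" where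
  "inscribed_polyominoes b h =
     {P. polyomino P \<and> P \<subseteq> {0..<int b} \<times> {0..<int h}
       \<and> (\<exists>y. (0, y) \<in> P) \<and> (\<exists>y. (int b - 1, y) \<in> P)
       \<and> (\<exists>x. (x, 0) \<in> P) \<and> (\<exists>x. (x, int h - 1) \<in> P)}"

definition stack_of :: "nat \<Rightarrow> nat \<Rightarrow> cell set \<Rightarrow> word list" where
  "stack_of b h P =
     map (\<lambda>y. map (\<lambda>x. if (int x, int y) \<in> P then 1 else 0) [0..<b]) [0..<h]"

section \<open>States\<close>

definition pos :: "nat \<Rightarrow> word \<Rightarrow> nat set" where
  "pos a w = {i. i < length w \<and> w ! i = a}"

definition max_letter :: "nat \<Rightarrow> nat" where
  "max_letter b = nat \<lceil>real b / 2\<rceil>"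

definition words :: "nat \<Rightarrow> word set" where
  "words b = {w. length w = b \<and> set w \<subseteq> {0..max_letter b}}"

definition empty_row :: "nat \<Rightarrow> state \<Rightarrow> bool" where
  "empty_row b = (\<lambda>(w, l, r). w = replicate b 0 \<longrightarrow> \<not> l \<and> \<not> r)"

definition inscription :: "nat \<Rightarrow> state \<Rightarrow> bool" where
  "inscription b = (\<lambda>(w, l, r). (w ! 0 \<noteq> 0 \<longrightarrow> l) \<and> (w ! (b - 1) \<noteq> 0 \<longrightarrow> r))"

definition separation :: "nat \<Rightarrow> word \<Rightarrow> bool" where
  "separation b w \<longleftrightarrow>
     (\<forall>i<b. w ! i \<noteq> 0 \<longrightarrow>
        (0 < i \<longrightarrow> w ! (i - 1) \<in> {0, w ! i}) \<and>
        (i + 1 < b \<longrightarrow> w ! (i + 1) \<in> {0, w ! i}))"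

definition non_crossing :: "nat \<Rightarrow> word \<Rightarrow> bool" where
  "non_crossing b w \<longleftrightarrow>
     (\<forall>i k j l. i < k \<and> k < j \<and> j < l \<and> l < b
        \<and> w ! i = w ! j \<and> w ! j \<noteq> 0 \<and> w ! k = w ! l \<and> w ! l \<noteq> 0 \<longrightarrow> w ! i = w ! k)"

definition triples :: "nat \<Rightarrow> state set" where
  "triples b =
     {(w, l, r). w \<in> words b \<and> empty_row b (w, l, r) \<and> inscription b (w, l, r)
        \<and> separation b w \<and> non_crossing b w}"

definition word_equiv :: "nat \<Rightarrow> word \<Rightarrow> word \<Rightarrow> bool" where
  "word_equiv b w w' \<longleftrightarrow> pos 0 w = pos 0 w' \<and>
     (\<exists>\<sigma>. \<sigma> permutes {1..max_letter b} \<and>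
        (\<forall>i\<in>{1..max_letter b}. pos i w = pos (\<sigma> i) w'))"

text \<open>The order on lists used by \<open>LEAST\<close> is the lexicographic one.\<close>

definition canon :: "nat \<Rightarrow> word \<Rightarrow> word" where
  "canon b w = (LEAST w'. w' \<in> words b \<and> word_equiv b w w')"

section \<open>The automaton\<close>

definition alphabet :: "nat \<Rightarrow> word set" where
  "alphabet b = {u. length u = b \<and> set u \<subseteq> {0, 1} \<and> card (pos 1 u) > 0}"

definition states :: "nat \<Rightarrow> state set" where
  "states b = {(canon b w, l, r) | w l r. (w, l, r) \<in> triples b}"

definition initial :: "nat \<Rightarrow> state" where
  "initial b = (replicate b 0, False, False)"

definition accepting :: "nat \<Rightarrow> state set" where
  "accepting b =
     {(canon b w, l, r) | w l r. (w, l, r) \<in> triples b \<and> set w \<subseteq> {0, 1} \<and> l \<and> r}"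

text \<open>\<open>vertical w u n\<close> is the prefix of length \<open>n\<close> of the word produced by the vertical step.\<close>

primrec vertical :: "word \<Rightarrow> word \<Rightarrow> nat \<Rightarrow> word" where
  "vertical w u 0 = []"
| "vertical w u (Suc n) =
     (let x = vertical w u n in
      x @ [if u ! n = 0 then 0
           else if w ! n \<noteq> 0 then w ! n
           else Max (set w \<union> set x) + 1])"

text \<open>A horizontally connected component is represented by its set of positions.\<close>

definition components :: "word \<Rightarrow> nat set set" where
  "components x =
     {{s..e} | s e. s \<le> e \<and> e < length x \<and> (\<forall>i\<in>{s..e}. x ! i \<noteq> 0)
        \<and> (s = 0 \<or> x ! (s - 1) = 0) \<and> (e + 1 = length x \<or> x ! (e + 1) = 0)}"

definition directly_linked :: "word \<Rightarrow> (nat set \<times> nat set) set" where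
  "directly_linked x =
     {(C, D). C \<in> components x \<and> D \<in> components x \<and> (!) x ` C \<inter> (!) x ` D \<noteq> {}}"

definition linked_classes :: "word \<Rightarrow> nat set set set" where
  "linked_classes x = components x // (directly_linked x)\<^sup>+"

definition leftmost :: "nat set set \<Rightarrow> nat" where
  "leftmost K = Min (\<Union>K)"

text \<open>
  Labelling the classes with 1, 2, \dots in the order of their leftmost components gives each class
  its rank in that order.
\<close>

definition class_letter :: "word \<Rightarrow> nat set set \<Rightarrow> nat" where
  "class_letter x K = card {K' \<in> linked_classes x. leftmost K' \<le> leftmost K}"

definition horizontal :: "word \<Rightarrow> word" where
  "horizontal x =
     map (\<lambda>i. if x ! i = 0 then 0
              else class_letter x (THE K. K \<in> linked_classes x \<and> i \<in> \<Union>K)) [0..<length x]"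

definition delta :: "nat \<Rightarrow> state \<Rightarrow> word \<Rightarrow> state option" where
  "delta b = (\<lambda>(w, l, r) u.
     if (w, l, r) \<in> states b \<and> u \<in> alphabet b
        \<and> (\<forall>a. a \<noteq> 0 \<and> pos a w \<noteq> {} \<longrightarrow> pos a w \<inter> pos 1 u \<noteq> {})
     then Some (canon b (horizontal (vertical w u b)), l \<or> u ! 0 = 1, r \<or> u ! (b - 1) = 1)
     else None)"

primrec run :: "nat \<Rightarrow> state \<Rightarrow> word list \<Rightarrow> state option" where
  "run b q [] = Some q"
| "run b q (u # us) = Option.bind (delta b q u) (\<lambda>q'. run b q' us)"

definition accepted_stacks :: "nat \<Rightarrow> nat \<Rightarrow> word list set" where
  "accepted_stacks b h =
     {us. length us = h \<and> set us \<subseteq> alphabet b \<and>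
        (\<exists>q\<in>accepting b. run b (initial b) us = Some q)}"

end

theory Submission imports Defs begin

text \<open>
  After the first \<open>k\<close> rows, the word of the state describes the connected components of the cells
  read so far: its nonzero positions are the cells of the last row, two of them carry the same
  letter iff they are connected within the first \<open>k\<close> rows, and every component reaches the last row.
  A transition is defined iff no component dies out, and the horizontal step takes the transitive
  closure of ``same letter or neighbouring'', which is exactly how connectivity changes when a row
  is added. The stack is accepted iff one component remains that has touched both sides. For the
  run to stay inside the state set, the words must remain non-crossing and use at most
  \<open>\<lceil>b / 2\<rceil>\<close> letters.
\<close>

section \<open>Letter patterns and canonical words\<close>

text \<open>Reading a subset of the rectangle row by row loses nothing, so the bijection comes down
  to one equivalence: the stack of a subset is accepted iff the subset is an inscribed polyomino.
  The states carry \<open>canon\<close>, a minimal representative whose letters are never computed.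
  All arguments therefore use only the zero positions and the equalities between letters, which are
  the data that renaming preserves. Connectivity is local because a path that leaves the newest row
  must enter the row above it, and can return only from there. Each such excursion is summarised by
  the equality of two letters. Since \<open>delta\<close> tests membership in \<open>states\<close>,
  closure of the state set under transitions belongs to the invariant. Its delicate part is
  planarity: instead of a curve argument on cells, non-crossing is carried through both steps on
  words, by counting how two paths of positions separate each other.\<close>

definition same_pattern :: "nat \<Rightarrow> word \<Rightarrow> word \<Rightarrow> bool" where
  "same_pattern b w w' \<longleftrightarrow>
     (\<forall>i<b. w ! i = 0 \<longleftrightarrow> w' ! i = 0) \<and> (\<forall>i<b. \<forall>j<b. w ! i = w ! j \<longleftrightarrow> w' ! i = w' ! j)"

lemma finite_words: "finite (words b)"
  unfolding words_def by (rule finite_subset[OF _ finite_lists_length_eq[of "{0..max_letter b}" b]]) auto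

lemma word_equiv_refl: "word_equiv b w w"
  unfolding word_equiv_def using permutes_id by (auto intro!: exI[of _ id])

lemma word_equiv_sym:
  assumes "word_equiv b w w'"
  shows "word_equiv b w' w"
proof -
  from assms obtain s where s: "pos 0 w = pos 0 w'" "s permutes {1..max_letter b}"
    "\<forall>i\<in>{1..max_letter b}. pos i w = pos (s i) w'"
    unfolding word_equiv_def by blast
  have "pos i w' = pos (inv s i) w" if "i \<in> {1..max_letter b}" for i
    using s(3) that permutes_in_image[OF permutes_inv[OF s(2)], of i] permutes_inverses(1)[OF s(2)]
    by auto
  then show ?thesis
    unfolding word_equiv_def using s(1) permutes_inv[OF s(2)] by metis
qed

lemma word_equiv_trans:
  assumes "word_equiv b w w'" "word_equiv b w' w''"
  shows "word_equiv b w w''"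
proof -
  from assms obtain s t where s: "pos 0 w = pos 0 w'" "s permutes {1..max_letter b}"
    "\<forall>i\<in>{1..max_letter b}. pos i w = pos (s i) w'"
    and t: "pos 0 w' = pos 0 w''" "t permutes {1..max_letter b}"
    "\<forall>i\<in>{1..max_letter b}. pos i w' = pos (t i) w''"
    unfolding word_equiv_def by blast
  have "\<forall>i\<in>{1..max_letter b}. pos i w = pos ((t \<circ> s) i) w''"
    using s(3) t(3) permutes_in_image[OF s(2)] by auto
  then show ?thesis
    unfolding word_equiv_def using s(1) t(1) permutes_compose[OF s(2) t(2)] by auto
qed

lemma canon_cong:
  assumes "word_equiv b w w'"
  shows "canon b w = canon b w'"
proof -
  have "word_equiv b w v \<longleftrightarrow> word_equiv b w' v" for v
    using assms word_equiv_sym word_equiv_trans by blast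
  then show ?thesis unfolding canon_def by simp
qed

text \<open>The lexicographic order on lists is not a well-order, so \<open>LEAST\<close> is
  identified with the minimum of a finite set. Words of fixed length over finitely many letters
  supply that finiteness.\<close>

lemma canon_properties:
  assumes "w \<in> words b"
  shows "canon b w \<in> words b" "word_equiv b w (canon b w)"
proof -
  let ?S = "{w'. w' \<in> words b \<and> word_equiv b w w'}"
  have fin: "finite ?S" by (rule finite_subset[OF _ finite_words[of b]]) auto
  have "w \<in> ?S" using assms word_equiv_refl by auto
  then have "canon b w = Min ?S"
    unfolding canon_def by (intro Least_Min fin) blast
  then have "canon b w \<in> ?S" using Min_in[OF fin] \<open>w \<in> ?S\<close> by auto
  then show "canon b w \<in> words b" "word_equiv b w (canon b w)" by auto
qed

text \<open>A permutation of \<open>{1..max_letter b}\<close> fixes 0, so \<open>w'\<close> arises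
  from \<open>w\<close> by applying \<open>s\<close> at every position. Injectivity of
  \<open>s\<close> then preserves and reflects equality of letters.\<close>

lemma word_equiv_same_pattern:
  assumes "w \<in> words b" "w' \<in> words b" "word_equiv b w w'"
  shows "same_pattern b w w'"
proof -
  from assms(3) obtain s where s: "pos 0 w = pos 0 w'" "s permutes {1..max_letter b}"
    "\<forall>i\<in>{1..max_letter b}. pos i w = pos (s i) w'"
    unfolding word_equiv_def by blast
  have len: "length w = b" "length w' = b" using assms(1,2) by (auto simp: words_def)
  have zero: "w ! i = 0 \<longleftrightarrow> w' ! i = 0" if "i < b" for i
    using s(1) that len unfolding pos_def by (auto simp: set_eq_iff)
  have image: "w' ! i = s (w ! i)" if "i < b" for i
  proof (cases "w ! i = 0")
    case True
    then show ?thesis using zero[OF that] permutes_not_in[OF s(2), of 0] by simp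
  next
    case False
    have "w ! i \<in> {1..max_letter b}"
      using assms(1) that False nth_mem[of i w] unfolding words_def by fastforce
    then have "pos (w ! i) w = pos (s (w ! i)) w'" using s(3) by blast
    moreover have "i \<in> pos (w ! i) w" using that len by (simp add: pos_def)
    ultimately show ?thesis by (simp add: pos_def)
  qed
  have "inj s" using s(2) by (rule permutes_inj)
  then show ?thesis
    unfolding same_pattern_def using zero image by (simp add: inj_eq)
qed

lemma canon_same_pattern: "w \<in> words b \<Longrightarrow> same_pattern b w (canon b w)"
  using canon_properties word_equiv_same_pattern by blast

lemma same_pattern_non_crossing:
  assumes "same_pattern b w w'" "non_crossing b w"
  shows "non_crossing b w'"
  unfolding non_crossing_def
proof (intro allI impI, elim conjE)
  fix i k j l
  assume h: "i < k" "k < j" "j < l" "l < b" "w' ! i = w' ! j" "w' ! j \<noteq> 0" "w' ! k = w' ! l" "w' ! l \<noteq> 0"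
  then have b: "i < b" "j < b" "k < b" by auto
  have "w ! i = w ! j" "w ! j \<noteq> 0" "w ! k = w ! l" "w ! l \<noteq> 0"
    using assms(1) h b unfolding same_pattern_def by simp_all
  then have "w ! i = w ! k" using assms(2) h unfolding non_crossing_def by blast
  then show "w' ! i = w' ! k" using assms(1) b unfolding same_pattern_def by simp
qed

lemma max_letter_eq: "max_letter b = (b + 1) div 2"
proof (cases "even b")
  case True
  then show ?thesis unfolding max_letter_def by (auto elim!: evenE)
next
  case False
  then obtain k where k: "b = 2 * k + 1" by (auto elim: oddE)
  have "\<lceil>real b / 2\<rceil> = int k + 1" unfolding k by (rule ceiling_unique) auto
  then show ?thesis unfolding max_letter_def k by simp
qed

lemma canon_replicate_0: "canon b (replicate b 0) = replicate b 0"
proof -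
  have w: "replicate b 0 \<in> words b" by (auto simp: words_def)
  show ?thesis
    using canon_same_pattern[OF w] canon_properties(1)[OF w]
    by (intro nth_equalityI) (auto simp: same_pattern_def words_def)
qed

section \<open>The vertical step\<close>

lemma length_vertical [simp]: "length (vertical w u n) = n"
  by (induction n) (auto simp: Let_def)

lemma nth_vertical_stable: "i < n \<Longrightarrow> n \<le> m \<Longrightarrow> vertical w u m ! i = vertical w u n ! i"
proof (induction m)
  case (Suc m)
  then show ?case by (cases "n = Suc m") (auto simp: Let_def nth_append)
qed simp

lemma nth_vertical:
  assumes "i < n"
  shows "vertical w u n ! i = (if u ! i = 0 then 0 else if w ! i \<noteq> 0 then w ! i
           else Max (set w \<union> set (vertical w u i)) + 1)"
proof -
  have "vertical w u n ! i = vertical w u (Suc i) ! i"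
    using assms by (intro nth_vertical_stable) auto
  then show ?thesis by (simp add: Let_def nth_append)
qed

lemma vertical_eq_0_iff: "i < n \<Longrightarrow> vertical w u n ! i = 0 \<longleftrightarrow> u ! i = 0"
  by (simp add: nth_vertical)

text \<open>A fresh letter is one more than the maximum over \<open>w\<close> and the prefix before
  \<open>i\<close>, hence differs from everything there. It may exceed \<open>max_letter b\<close>;
  the renumbering in the horizontal step restores the bound.\<close>

lemma vertical_new_letter:
  assumes "i < n" "u ! i \<noteq> 0" "w ! i = 0"
  shows "vertical w u n ! i \<notin> set w" "j < i \<Longrightarrow> vertical w u n ! j \<noteq> vertical w u n ! i"
proof -
  let ?A = "set w \<union> set (vertical w u i)"
  have eq: "vertical w u n ! i = Max ?A + 1" using assms by (simp add: nth_vertical)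
  have new: "a \<noteq> vertical w u n ! i" if "a \<in> ?A" for a
    using Max_ge[of ?A a] that eq by fastforce
  show "vertical w u n ! i \<notin> set w" using new by blast
  assume "j < i"
  then have "vertical w u n ! j = vertical w u i ! j"
    using assms by (intro nth_vertical_stable) auto
  moreover have "vertical w u i ! j \<in> set (vertical w u i)" using \<open>j < i\<close> by simp
  ultimately show "vertical w u n ! j \<noteq> vertical w u n ! i" using new by simp
qed

text \<open>Only letters inherited from \<open>w\<close> can coincide: a fresh letter avoids
  \<open>set w\<close>, and of two fresh letters the right one avoids everything to its
  left.\<close>

lemma vertical_eq_iff:
  assumes "length w = n" "i < n" "j < n" "i \<noteq> j" "u ! i \<noteq> 0" "u ! j \<noteq> 0"
  shows "vertical w u n ! i = vertical w u n ! j \<longleftrightarrow> w ! i = w ! j \<and> w ! i \<noteq> 0"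
proof -
  have old: "vertical w u n ! k = w ! k" "vertical w u n ! k \<in> set w" if "k < n" "w ! k \<noteq> 0" "u ! k \<noteq> 0" for k
    using that assms(1) by (auto simp: nth_vertical)
  show ?thesis
  proof (cases "w ! i = 0 \<or> w ! j = 0")
    case True
    then have "vertical w u n ! i \<noteq> vertical w u n ! j"
      using assms old vertical_new_letter[of i n u w] vertical_new_letter[of j n u w]
      by (metis nat_neq_iff)
    then show ?thesis using True by auto
  next
    case False
    then show ?thesis using old assms by auto
  qed
qed

section \<open>The horizontal step\<close>

text \<open>Linking is rephrased as a graph on single positions: its connected components are the
  unions of the linked classes. In this form it can be compared with paths of cells.\<close>

definition position_step :: "word \<Rightarrow> (nat \<times> nat) set" where
  "position_step x = {(i, j). i < length x \<and> j < length x \<and> x ! i \<noteq> 0 \<and> x ! j \<noteq> 0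
     \<and> (x ! i = x ! j \<or> j = Suc i \<or> i = Suc j)}"

lemma sym_position_step: "sym (position_step x)"
  by (auto simp: sym_def position_step_def)

lemma component_exists:
  assumes "i < length x" "x ! i \<noteq> 0"
  shows "\<exists>C\<in>components x. i \<in> C"
proof -
  define s where "s = (LEAST s. s \<le> i \<and> (\<forall>t\<in>{s..i}. x ! t \<noteq> 0))"
  have s: "s \<le> i \<and> (\<forall>t\<in>{s..i}. x ! t \<noteq> 0)"
    unfolding s_def by (rule LeastI[of _ i]) (use assms in auto)
  have s': "s = 0 \<or> x ! (s - 1) = 0"
  proof (rule ccontr)
    assume h: "\<not> (s = 0 \<or> x ! (s - 1) = 0)"
    then have "{s - 1..i} = insert (s - 1) {s..i}" using s by auto
    then have "s - 1 \<le> i \<and> (\<forall>t\<in>{s - 1..i}. x ! t \<noteq> 0)" using s h by auto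
    then have "s \<le> s - 1" unfolding s_def by (rule Least_le)
    then show False using h by auto
  qed
  define Q where "Q = (\<lambda>e. i \<le> e \<and> e < length x \<and> (\<forall>t\<in>{i..e}. x ! t \<noteq> 0))"
  define e where "e = (GREATEST e. Q e)"
  have bd: "\<And>y. Q y \<Longrightarrow> y \<le> length x" by (auto simp: Q_def)
  have Qi: "Q i" using assms by (auto simp: Q_def)
  have e: "Q e" unfolding e_def using Qi bd by (rule GreatestI_nat)
  have e': "e + 1 = length x \<or> x ! (e + 1) = 0"
  proof (rule ccontr)
    assume h: "\<not> (e + 1 = length x \<or> x ! (e + 1) = 0)"
    have "{i..e + 1} = insert (e + 1) {i..e}" using e by (auto simp: Q_def)
    then have "Q (e + 1)" using e h by (auto simp: Q_def)
    then have "e + 1 \<le> e" unfolding e_def using bd by (rule Greatest_le_nat)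
    then show False by auto
  qed
  have "\<forall>t\<in>{s..e}. x ! t \<noteq> 0"
  proof
    fix t assume "t \<in> {s..e}"
    then show "x ! t \<noteq> 0" using s e unfolding Q_def by (cases "t \<le> i") auto
  qed
  then have "{s..e} \<in> components x" unfolding components_def using s s' e e' by (auto simp: Q_def)
  then show ?thesis using s e by (intro bexI[of _ "{s..e}"]) (auto simp: Q_def)
qed

lemma component_unique:
  assumes "C \<in> components x" "D \<in> components x" "i \<in> C" "i \<in> D"
  shows "C = D"
proof -
  obtain s e where C: "C = {s..e}" "s \<le> e" "e < length x" "\<forall>i\<in>{s..e}. x ! i \<noteq> 0"
    "s = 0 \<or> x ! (s - 1) = 0" "e + 1 = length x \<or> x ! (e + 1) = 0"
    using assms(1) unfolding components_def by blast
  obtain s' e' where D: "D = {s'..e'}" "s' \<le> e'" "e' < length x" "\<forall>i\<in>{s'..e'}. x ! i \<noteq> 0"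
    "s' = 0 \<or> x ! (s' - 1) = 0" "e' + 1 = length x \<or> x ! (e' + 1) = 0"
    using assms(2) unfolding components_def by blast
  have i: "s \<le> i" "i \<le> e" "s' \<le> i" "i \<le> e'" using assms C D by auto
  have "\<not> s < s'"
  proof
    assume "s < s'"
    then have "s' - 1 \<in> {s..e}" using i by auto
    then show False using bspec[OF C(4)] D(5) \<open>s < s'\<close> by force
  qed
  moreover have "\<not> s' < s"
  proof
    assume "s' < s"
    then have "s - 1 \<in> {s'..e'}" using i by auto
    then show False using bspec[OF D(4)] C(5) \<open>s' < s\<close> by force
  qed
  moreover have "\<not> e < e'"
  proof
    assume "e < e'"
    then have "e + 1 \<in> {s'..e'}" using i by auto
    then show False using bspec[OF D(4)] D(3) C(6) \<open>e < e'\<close> by force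
  qed
  moreover have "\<not> e' < e"
  proof
    assume "e' < e"
    then have "e' + 1 \<in> {s..e}" using i by auto
    then show False using bspec[OF C(4)] C(3) D(6) \<open>e' < e\<close> by force
  qed
  ultimately show ?thesis using C D by auto
qed

lemma component_position: "C \<in> components x \<Longrightarrow> i \<in> C \<Longrightarrow> i < length x \<and> x ! i \<noteq> 0"
  unfolding components_def by auto

lemma component_Suc:
  assumes "C \<in> components x" "i \<in> C" "Suc i < length x" "x ! Suc i \<noteq> 0"
  shows "Suc i \<in> C"
  using assms unfolding components_def by (auto simp: not_less_eq_eq le_antisym)

lemma component_connected:
  assumes "C \<in> components x" "i \<in> C" "j \<in> C"
  shows "(i, j) \<in> (position_step x)\<^sup>*"
proof -
  have up: "(i, i + d) \<in> (position_step x)\<^sup>*" if "i \<in> C" "i + d \<in> C" for i d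
    using that
  proof (induction d)
    case (Suc d)
    have "i + d \<in> C" using assms(1) Suc.prems unfolding components_def by auto
    moreover have "(i + d, i + Suc d) \<in> position_step x"
      using component_position[OF assms(1)] Suc.prems \<open>i + d \<in> C\<close> by (auto simp: position_step_def)
    ultimately show ?case using Suc by (meson rtrancl.rtrancl_into_rtrancl)
  qed simp
  show ?thesis
  proof (cases "i \<le> j")
    case True
    then show ?thesis using up[of i "j - i"] assms by auto
  next
    case False
    then have "(j, i) \<in> (position_step x)\<^sup>*" using up[of j "i - j"] assms by auto
    then show ?thesis using sym_rtrancl[OF sym_position_step] by (auto dest: symD)
  qed
qed

text \<open>A direct link is an equal-letter step between some positions of the two components, and
  walks inside a component connect such positions. Conversely an equal-letter step is a direct link,
  while a neighbour step stays inside one component.\<close>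

lemma linked_iff:
  assumes "C \<in> components x" "D \<in> components x" "i \<in> C" "j \<in> D"
  shows "(C, D) \<in> (directly_linked x)\<^sup>+ \<longleftrightarrow> (i, j) \<in> (position_step x)\<^sup>*"
proof
  assume "(C, D) \<in> (directly_linked x)\<^sup>+"
  then have "\<forall>j\<in>D. (i, j) \<in> (position_step x)\<^sup>*"
  proof (induction rule: trancl_induct)
    case (base D)
    then obtain i' j' where h: "C \<in> components x" "D \<in> components x" "i' \<in> C" "j' \<in> D" "x ! i' = x ! j'"
      unfolding directly_linked_def by blast
    then have "(i', j') \<in> position_step x"
      using component_position by (auto simp: position_step_def)
    then show ?case
      using component_connected[OF h(1) assms(3) h(3)] component_connected[OF h(2,4)]
      by (meson rtrancl.rtrancl_into_rtrancl rtrancl_trans)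
  next
    case (step D E)
    then obtain i' j' where h: "D \<in> components x" "E \<in> components x" "i' \<in> D" "j' \<in> E" "x ! i' = x ! j'"
      unfolding directly_linked_def by blast
    then have "(i', j') \<in> position_step x"
      using component_position by (auto simp: position_step_def)
    then show ?case
      using step.IH h(3) component_connected[OF h(2,4)]
      by (meson rtrancl.rtrancl_into_rtrancl rtrancl_trans)
  qed
  then show "(i, j) \<in> (position_step x)\<^sup>*" using assms(4) by blast
next
  assume "(i, j) \<in> (position_step x)\<^sup>*"
  then have "\<forall>D\<in>components x. j \<in> D \<longrightarrow> (C, D) \<in> (directly_linked x)\<^sup>+"
  proof (induction rule: rtrancl_induct)
    case base
    have "(C, C) \<in> directly_linked x" using assms(1,3) by (auto simp: directly_linked_def)
    then show ?case using component_unique assms(1,3) by blast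
  next
    case (step j k)
    show ?case
    proof (intro ballI impI)
      fix D assume D: "D \<in> components x" "k \<in> D"
      have jk: "j < length x" "x ! j \<noteq> 0" "k < length x" "x ! k \<noteq> 0"
        "x ! j = x ! k \<or> k = Suc j \<or> j = Suc k"
        using step.hyps(2) by (auto simp: position_step_def)
      obtain E where E: "E \<in> components x" "j \<in> E" using component_exists jk by blast
      have CE: "(C, E) \<in> (directly_linked x)\<^sup>+" using step.IH E by blast
      show "(C, D) \<in> (directly_linked x)\<^sup>+"
      proof (cases "x ! j = x ! k")
        case True
        then have "(E, D) \<in> directly_linked x"
          unfolding directly_linked_def using D E by blast
        then show ?thesis using CE by (meson trancl_into_trancl)
      next
        case False
        then have "E = D"
          using jk component_Suc[OF E] component_Suc[OF D] component_unique D E by metis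
        then show ?thesis using CE by simp
      qed
    qed
  qed
  then show "(C, D) \<in> (directly_linked x)\<^sup>+" using assms by blast
qed

section \<open>Linked classes and their numbering\<close>

lemma equiv_linked: "equiv (components x) ((directly_linked x)\<^sup>+)"
proof (rule equivI)
  show "(directly_linked x)\<^sup>+ \<subseteq> components x \<times> components x"
    by (rule trancl_subset_Sigma) (auto simp: directly_linked_def)
  \<comment> \<open>A nonempty component shares a letter with itself, so \<open>(C, C)\<close> is
    already a direct link. This makes the non-reflexive closure reflexive on components.\<close>
  have "C \<noteq> {}" if "C \<in> components x" for C using that by (auto simp: components_def)
  then show "refl_on (components x) ((directly_linked x)\<^sup>+)"
    by (fastforce simp: refl_on_def directly_linked_def intro!: r_into_trancl)
  have "sym (directly_linked x)" by (auto simp: sym_def directly_linked_def)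
  then show "sym ((directly_linked x)\<^sup>+)" by (rule sym_trancl)
qed simp

lemma finite_components: "finite (components x)"
proof -
  have "components x \<subseteq> (\<lambda>(s, e). {s..e}) ` ({..<length x} \<times> {..<length x})"
    unfolding components_def by fastforce
  then show ?thesis by (rule finite_subset) auto
qed

lemma finite_linked_classes: "finite (linked_classes x)"
  unfolding linked_classes_def
  using equiv_linked finite_components by (metis equiv_type finite_quotient)

lemma linked_class_subset: "K \<in> linked_classes x \<Longrightarrow> K \<subseteq> components x"
  unfolding linked_classes_def using equiv_linked by (metis in_quotient_imp_subset)

lemma linked_class_unique:
  assumes "K \<in> linked_classes x" "L \<in> linked_classes x" "i \<in> \<Union>K" "i \<in> \<Union>L"
  shows "K = L"
proof -
  obtain C D where CD: "C \<in> K" "i \<in> C" "D \<in> L" "i \<in> D" using assms by blast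
  then have "C = D"
    using component_unique linked_class_subset[OF assms(1)] linked_class_subset[OF assms(2)] by blast
  then show ?thesis
    using quotient_disj[OF equiv_linked] assms(1,2) CD unfolding linked_classes_def by fast
qed

text \<open>The least position of a class starts the component containing it, so it is preceded by a
  0 or by the border of the word. This gap keeps the leftmost positions of two classes from being
  adjacent.\<close>

lemma leftmost_properties:
  assumes "K \<in> linked_classes x"
  shows "leftmost K \<in> \<Union>K" "leftmost K = 0 \<or> x ! (leftmost K - 1) = 0"
    "leftmost K < length x" "x ! leftmost K \<noteq> 0"
proof -
  have sub: "K \<subseteq> components x" using assms by (rule linked_class_subset)
  have pos: "i < length x \<and> x ! i \<noteq> 0" if "i \<in> \<Union>K" for i
    using that sub component_position by blast
  then have "\<Union>K \<subseteq> {..<length x}" by blast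
  then have fin: "finite (\<Union>K)" by (rule finite_subset) simp
  have "K \<noteq> {}" using assms equiv_linked unfolding linked_classes_def by (metis in_quotient_imp_non_empty)
  moreover have "C \<noteq> {}" if "C \<in> K" for C using sub that by (auto simp: components_def)
  ultimately have "\<Union>K \<noteq> {}" by auto
  then show mem: "leftmost K \<in> \<Union>K" unfolding leftmost_def using fin by (rule Min_in[rotated])
  then show "leftmost K < length x" "x ! leftmost K \<noteq> 0" using pos by blast+
  obtain C where C: "C \<in> K" "leftmost K \<in> C" using mem by blast
  then have "C \<in> components x" using sub by blast
  then obtain s e where se: "C = {s..e}" "s \<le> e" "s = 0 \<or> x ! (s - 1) = 0"
    unfolding components_def by blast
  have "s \<in> \<Union>K" using se C by auto
  then have "leftmost K \<le> s" unfolding leftmost_def using fin by (intro Min_le)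
  moreover have "s \<le> leftmost K" using C se by auto
  ultimately show "leftmost K = 0 \<or> x ! (leftmost K - 1) = 0" using se by auto
qed

lemma inj_on_leftmost: "inj_on leftmost (linked_classes x)"
  by (intro inj_onI) (metis leftmost_properties(1) linked_class_unique)

text \<open>Leftmost positions of distinct classes differ by at least 2, whence at most
  \<open>\<lceil>b / 2\<rceil>\<close> letters are needed.\<close>

lemma card_linked_classes_le: "card (linked_classes x) \<le> max_letter (length x)"
proof -
  have "inj_on (\<lambda>K. leftmost K div 2) (linked_classes x)"
  proof (rule inj_onI)
    fix K L assume h: "K \<in> linked_classes x" "L \<in> linked_classes x" "leftmost K div 2 = leftmost L div 2"
    have "leftmost K = leftmost L \<or> leftmost K = Suc (leftmost L) \<or> leftmost L = Suc (leftmost K)"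
      using h(3) by presburger
    then have "leftmost K = leftmost L"
      using leftmost_properties[OF h(1)] leftmost_properties[OF h(2)] by auto
    then show "K = L" using inj_on_leftmost h by (auto dest: inj_onD)
  qed
  moreover have "(\<lambda>K. leftmost K div 2) ` linked_classes x \<subseteq> {..<max_letter (length x)}"
    using leftmost_properties(3) by (force simp: max_letter_eq)
  ultimately show ?thesis using card_inj_on_le[of _ "linked_classes x" "{..<max_letter (length x)}"] by simp
qed

text \<open>Ranks grow strictly with \<open>leftmost\<close>: the class further right counts itself
  in addition to everything the other one counts.\<close>

lemma inj_on_class_letter: "inj_on (class_letter x) (linked_classes x)"
proof -
  have less: "class_letter x K < class_letter x L"
    if "K \<in> linked_classes x" "L \<in> linked_classes x" "leftmost K < leftmost L" for K L
    unfolding class_letter_def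
  proof (rule psubset_card_mono)
    show "finite {K' \<in> linked_classes x. leftmost K' \<le> leftmost L}" using finite_linked_classes by simp
    show "{K' \<in> linked_classes x. leftmost K' \<le> leftmost K} \<subset> {K' \<in> linked_classes x. leftmost K' \<le> leftmost L}"
    proof
      show "{K' \<in> linked_classes x. leftmost K' \<le> leftmost K} \<subseteq> {K' \<in> linked_classes x. leftmost K' \<le> leftmost L}"
        using that by auto
      have "L \<in> {K' \<in> linked_classes x. leftmost K' \<le> leftmost L}"
        "L \<notin> {K' \<in> linked_classes x. leftmost K' \<le> leftmost K}"
        using that by auto
      then show "{K' \<in> linked_classes x. leftmost K' \<le> leftmost K} \<noteq> {K' \<in> linked_classes x. leftmost K' \<le> leftmost L}"
        by blast
    qed
  qed
  show ?thesis
  proof (rule inj_onI)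
    fix K L assume h: "K \<in> linked_classes x" "L \<in> linked_classes x" "class_letter x K = class_letter x L"
    then have "leftmost K = leftmost L" using less by (metis nat_neq_iff)
    then show "K = L" using inj_on_leftmost h by (auto dest: inj_onD)
  qed
qed

text \<open>A class counts itself, so its letter is at least 1 and cannot be confused with the 0 of
  an empty cell.\<close>

lemma class_letter_bounds:
  assumes "K \<in> linked_classes x"
  shows "1 \<le> class_letter x K" "class_letter x K \<le> max_letter (length x)"
proof -
  let ?S = "{K' \<in> linked_classes x. leftmost K' \<le> leftmost K}"
  have "finite ?S" "K \<in> ?S" using finite_linked_classes assms by auto
  then have "card ?S > 0" by (auto simp: card_gt_0_iff)
  then show "1 \<le> class_letter x K" by (simp add: class_letter_def)
  have "card ?S \<le> card (linked_classes x)" using finite_linked_classes by (intro card_mono) auto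
  then show "class_letter x K \<le> max_letter (length x)"
    using card_linked_classes_le[of x] by (simp add: class_letter_def)
qed

lemma length_horizontal [simp]: "length (horizontal x) = length x"
  by (simp add: horizontal_def)

lemma nth_horizontal:
  assumes "i < length x" "x ! i \<noteq> 0" "C \<in> components x" "i \<in> C"
  shows "horizontal x ! i = class_letter x ((directly_linked x)\<^sup>+ `` {C})"
    and "(directly_linked x)\<^sup>+ `` {C} \<in> linked_classes x"
proof -
  let ?K = "(directly_linked x)\<^sup>+ `` {C}"
  show K: "?K \<in> linked_classes x" unfolding linked_classes_def using assms(3) by (rule quotientI)
  have "C \<in> ?K" using equiv_class_self[OF equiv_linked assms(3)] .
  then have i: "i \<in> \<Union>?K" using assms(4) by blast
  have "(THE K. K \<in> linked_classes x \<and> i \<in> \<Union>K) = ?K"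
  proof (rule the_equality)
    show "?K \<in> linked_classes x \<and> i \<in> \<Union>?K" using K i by blast
    show "L = ?K" if "L \<in> linked_classes x \<and> i \<in> \<Union>L" for L
      using linked_class_unique K i that by blast
  qed
  then show "horizontal x ! i = class_letter x ?K" using assms by (simp add: horizontal_def)
qed

lemma horizontal_eq_0_iff:
  assumes "i < length x"
  shows "horizontal x ! i = 0 \<longleftrightarrow> x ! i = 0"
proof (cases "x ! i = 0")
  case False
  then obtain C where "C \<in> components x" "i \<in> C" using component_exists assms by blast
  then show ?thesis
    using nth_horizontal[OF assms False] class_letter_bounds(1) False by fastforce
qed (use assms in \<open>simp add: horizontal_def\<close>)

lemma horizontal_in_words: "horizontal x \<in> words (length x)"
proof -
  have "horizontal x ! i \<le> max_letter (length x)" if i: "i < length x" for i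
  proof (cases "x ! i = 0")
    case True
    then show ?thesis using horizontal_eq_0_iff[OF i] by simp
  next
    case False
    then obtain C where C: "C \<in> components x" "i \<in> C" using component_exists i by blast
    show ?thesis
      unfolding nth_horizontal(1)[OF i False C]
      by (rule class_letter_bounds(2)[OF nth_horizontal(2)[OF i False C]])
  qed
  then have "\<forall>a\<in>set (horizontal x). a \<le> max_letter (length x)"
    unfolding all_set_conv_all_nth by simp
  then show ?thesis unfolding words_def by auto
qed

text \<open>The numbering disappears here: injectivity of \<open>class_letter\<close> turns equal
  letters into equal classes, and \<open>linked_iff\<close> turns these into a path of
  positions.\<close>

lemma horizontal_eq_iff:
  assumes "i < length x" "j < length x" "x ! i \<noteq> 0" "x ! j \<noteq> 0"
  shows "horizontal x ! i = horizontal x ! j \<longleftrightarrow> (i, j) \<in> (position_step x)\<^sup>*"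
proof -
  obtain C D where CD: "C \<in> components x" "i \<in> C" "D \<in> components x" "j \<in> D"
    using component_exists assms by blast
  have "horizontal x ! i = horizontal x ! j \<longleftrightarrow>
    (directly_linked x)\<^sup>+ `` {C} = (directly_linked x)\<^sup>+ `` {D}"
    using nth_horizontal[OF assms(1,3) CD(1,2)] nth_horizontal[OF assms(2,4) CD(3,4)]
    by (simp add: inj_on_eq_iff[OF inj_on_class_letter])
  also have "\<dots> \<longleftrightarrow> (C, D) \<in> (directly_linked x)\<^sup>+"
    using eq_equiv_class_iff[OF equiv_linked CD(1,3)] by simp
  finally show ?thesis using linked_iff CD by metis
qed

lemma separation_horizontal: "separation (length x) (horizontal x)"
proof -
  have *: "horizontal x ! i = horizontal x ! Suc i"
    if "Suc i < length x" "horizontal x ! i \<noteq> 0" "horizontal x ! Suc i \<noteq> 0" for i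
  proof -
    have nz: "x ! i \<noteq> 0" "x ! Suc i \<noteq> 0" using that horizontal_eq_0_iff by auto
    then have "(i, Suc i) \<in> position_step x" using that by (auto simp: position_step_def)
    then show ?thesis using horizontal_eq_iff nz that by auto
  qed
  show ?thesis
    unfolding separation_def
  proof (intro allI impI conjI)
    fix i assume i: "i < length x" "horizontal x ! i \<noteq> 0"
    show "horizontal x ! (i - 1) \<in> {0, horizontal x ! i}" if "0 < i"
      using *[of "i - 1"] i that by fastforce
    show "horizontal x ! (i + 1) \<in> {0, horizontal x ! i}" if "i + 1 < length x"
      using *[of i] i that by fastforce
  qed
qed

text \<open>Say that \<open>p\<close> separates \<open>k\<close> and \<open>l\<close> if exactly one of them lies left of \<open>p\<close>. Along a path in
  one class, no step can change whether a pair of positions in another class is separated: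
  otherwise a step of the first path would cross a step of a path joining that pair.\<close>

lemma non_crossing_horizontal:
  assumes "non_crossing (length x) x"
  shows "non_crossing (length x) (horizontal x)"
  unfolding non_crossing_def
proof (intro allI impI, elim conjE, rule ccontr)
  fix i k j l
  assume h: "i < k" "k < j" "j < l" "l < length x" "horizontal x ! i = horizontal x ! j"
    "horizontal x ! j \<noteq> 0" "horizontal x ! k = horizontal x ! l" "horizontal x ! l \<noteq> 0"
    and ne: "horizontal x ! i \<noteq> horizontal x ! k"
  have nz: "x ! i \<noteq> 0" "x ! j \<noteq> 0" "x ! k \<noteq> 0" "x ! l \<noteq> 0"
    using h horizontal_eq_0_iff by (metis less_trans)+
  let ?R = "position_step x"
  have ij: "(i, j) \<in> ?R\<^sup>*" and kl: "(k, l) \<in> ?R\<^sup>*" and ik: "(i, k) \<notin> ?R\<^sup>*"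
    using h ne nz horizontal_eq_iff by auto
  have sym: "(q, p) \<in> ?R\<^sup>*" if "(p, q) \<in> ?R\<^sup>*" for p q
    using sym_rtrancl[OF sym_position_step] that by (auto dest: symD)
  have nc: "\<not> (p < q \<and> q < r \<and> r < s)" if "(p, r) \<in> ?R" "(q, s) \<in> ?R" "x ! p = x ! r"
    "x ! q = x ! s" "x ! p \<noteq> x ! q" for p q r s
    using assms that unfolding non_crossing_def position_step_def by blast
  have cross: "(c < p) = (d < p) \<longleftrightarrow> (c < q) = (d < q)"
    if pq: "(p, q) \<in> ?R" and cd: "(c, d) \<in> ?R" and pc: "(p, c) \<notin> ?R\<^sup>*" for p q c d
  proof -
    have conn: "(p, q) \<in> ?R\<^sup>*" "(d, c) \<in> ?R\<^sup>*" "(q, p) \<in> ?R" "(d, c) \<in> ?R"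
      using pq cd sym_position_step by (auto dest: symD)
    then have ne: "p \<noteq> c" "q \<noteq> c" "p \<noteq> d" "q \<noteq> d"
      using pc by (auto intro: rtrancl_trans)
    have pc': "x ! p \<noteq> x ! c"
      using pq cd pc by (auto simp: position_step_def)
    consider "q = Suc p \<or> p = Suc q \<or> d = Suc c \<or> c = Suc d" | "x ! p = x ! q" "x ! c = x ! d"
      using pq cd by (auto simp: position_step_def)
    then show ?thesis
    proof cases
      \<comment> \<open>A neighbour step has no position strictly between its ends. As the two steps
        share no endpoint, neither can be separated by the other.\<close>
      case 1
      then show ?thesis using ne by linarith
    next
      case 2
      \<comment> \<open>Both steps now join equal letters, with different letters for the two steps.
        The eight instances run over the orientations of both steps and over which of them supplies
        the leftmost position.\<close>
      show ?thesis
        using ne nc[OF pq cd] nc[OF pq conn(4)] nc[OF conn(3) cd] nc[OF conn(3,4)]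
          nc[OF cd pq] nc[OF cd conn(3)] nc[OF conn(4) pq] nc[OF conn(4,3)] 2 pc'
        by (smt (verit) linorder_neqE_nat)
    qed
  qed
  have all: "(k < p) = (d < p) \<longleftrightarrow> (k < q) = (d < q)"
    if pq: "(p, q) \<in> ?R" and ip: "(i, p) \<in> ?R\<^sup>*" and "(k, d) \<in> ?R\<^sup>*" for p q d
    using that(3)
  proof (induction rule: rtrancl_induct)
    case (step c d)
    have "(p, c) \<notin> ?R\<^sup>*" using ip step.hyps(1) ik sym by (meson rtrancl_trans)
    then show ?case using cross[OF pq step.hyps(2)] step.IH by blast
  qed simp
  \<comment> \<open>Walk from \<open>i\<close> to \<open>j\<close>: at the start neither
    \<open>k\<close> nor \<open>l\<close> lies to the left, and \<open>all\<close> preserves this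
    agreement. At \<open>j\<close> it fails, because \<open>k < j < l\<close>.\<close>
  have "(k < j) = (l < j)"
    using ij
  proof (induction rule: rtrancl_induct)
    case base
    show ?case using h by auto
  next
    case (step p q)
    then show ?case using all[OF step.hyps(2,1) kl] by blast
  qed
  then show False using h by auto
qed

section \<open>Connectivity row by row\<close>

definition cell_step :: "cell set \<Rightarrow> (cell \<times> cell) set" where
  "cell_step P = {(c, d). c \<in> P \<and> d \<in> P \<and> adjacent c d}"

definition upper :: "cell set \<Rightarrow> nat \<Rightarrow> cell set" where
  "upper P k = {c \<in> P. snd c < int k}"

lemma cell_step_converse: "(c, d) \<in> (cell_step P)\<^sup>* \<Longrightarrow> (d, c) \<in> (cell_step P)\<^sup>*"
proof -
  have "sym (cell_step P)" by (auto simp: sym_def cell_step_def adjacent_def abs_minus_commute)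
  then show "(c, d) \<in> (cell_step P)\<^sup>* \<Longrightarrow> (d, c) \<in> (cell_step P)\<^sup>*"
    using sym_rtrancl by (auto dest: symD)
qed

lemma cell_step_mono: "P \<subseteq> Q \<Longrightarrow> (cell_step P)\<^sup>* \<subseteq> (cell_step Q)\<^sup>*"
  by (intro rtrancl_mono) (auto simp: cell_step_def)

lemma upper_Suc_mono: "(c, d) \<in> (cell_step (upper P k))\<^sup>* \<Longrightarrow> (c, d) \<in> (cell_step (upper P (Suc k)))\<^sup>*"
  by (rule subsetD[OF cell_step_mono]) (auto simp: upper_def)

lemma vertical_cell_step:
  assumes "(i, int k - 1) \<in> P" "(i, int k) \<in> P"
  shows "((i, int k - 1), (i, int k)) \<in> cell_step (upper P (Suc k))"
  using assms by (auto simp: cell_step_def upper_def adjacent_def)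

lemma vertical_cell_step_up:
  assumes "(i, int k - 1) \<in> P" "(i, int k) \<in> P"
  shows "((i, int k), (i, int k - 1)) \<in> cell_step (upper P (Suc k))"
  using assms by (auto simp: cell_step_def upper_def adjacent_def)

text \<open>A path within the first \<open>k + 1\<close> rows alternates between stretches in row
  \<open>k\<close> and excursions into the rows above. Stretches are neighbour steps. An excursion
  joins two cells of row \<open>k - 1\<close> that are connected in \<open>upper P k\<close>, so by
  \<open>eq\<close> the positions below them are equal or carry the same letter.\<close>

lemma position_step_iff_connected:
  assumes P: "P \<subseteq> {0..<int b} \<times> {0..}"
    and len: "length x = b"
    and nz: "\<And>i. i < b \<Longrightarrow> x ! i \<noteq> 0 \<longleftrightarrow> (int i, int k) \<in> P"
    and eq: "\<And>i j. i < b \<Longrightarrow> j < b \<Longrightarrow> i \<noteq> j \<Longrightarrow> x ! i \<noteq> 0 \<Longrightarrow> x ! j \<noteq> 0 \<Longrightarrow>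
      x ! i = x ! j \<longleftrightarrow> (int i, int k - 1) \<in> P \<and> (int j, int k - 1) \<in> P \<and>
        ((int i, int k - 1), (int j, int k - 1)) \<in> (cell_step (upper P k))\<^sup>*"
    and i: "i < b" "x ! i \<noteq> 0" and j: "j < b"
  shows "(i, j) \<in> (position_step x)\<^sup>* \<longleftrightarrow>
    ((int i, int k), (int j, int k)) \<in> (cell_step (upper P (Suc k)))\<^sup>*"
proof
  let ?S = "(cell_step (upper P (Suc k)))\<^sup>*"
  assume "(i, j) \<in> (position_step x)\<^sup>*"
  then show "((int i, int k), (int j, int k)) \<in> ?S"
  proof (induction rule: rtrancl_induct)
    case (step p q)
    from step.hyps(2) have pq: "p < b" "q < b" "x ! p \<noteq> 0" "x ! q \<noteq> 0"
      "x ! p = x ! q \<or> q = Suc p \<or> p = Suc q"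
      by (auto simp: position_step_def len)
    have cells: "(int p, int k) \<in> P" "(int q, int k) \<in> P" using nz pq by auto
    have "((int p, int k), (int q, int k)) \<in> ?S"
    proof (cases "x ! p = x ! q \<and> p \<noteq> q")
      case True
      then have e: "(int p, int k - 1) \<in> P" "(int q, int k - 1) \<in> P"
        "((int p, int k - 1), (int q, int k - 1)) \<in> (cell_step (upper P k))\<^sup>*"
        using eq[OF pq(1,2)] pq by auto
      show ?thesis
        using vertical_cell_step_up[OF e(1) cells(1)] upper_Suc_mono[OF e(3)] vertical_cell_step[OF e(2) cells(2)]
        by (meson converse_rtrancl_into_rtrancl rtrancl.rtrancl_into_rtrancl)
    next
      case False
      then have "p = q \<or> ((int p, int k), (int q, int k)) \<in> cell_step (upper P (Suc k))"
        using pq cells by (auto simp: cell_step_def upper_def adjacent_def)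
      then show ?thesis by auto
    qed
    then show ?case using step.IH by (rule rtrancl_trans[rotated])
  qed simp
next
  let ?S = "(cell_step (upper P (Suc k)))\<^sup>*"
  let ?T = "(cell_step (upper P k))\<^sup>*"
  \<comment> \<open>The invariant along the cell path. In row \<open>k\<close> it records that the
    current position is reached; during an excursion it remembers a reached position
    \<open>p\<close> below whose upper neighbour the excursion is attached.\<close>
  define reach where "reach c \<longleftrightarrow> (if snd c = int k then (i, nat (fst c)) \<in> (position_step x)\<^sup>*
    else \<exists>p<b. (i, p) \<in> (position_step x)\<^sup>* \<and> x ! p \<noteq> 0 \<and> (int p, int k - 1) \<in> P \<and> ((int p, int k - 1), c) \<in> ?T)" for c
  assume "((int i, int k), (int j, int k)) \<in> ?S"
  then have "reach (int j, int k)"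
  proof (induction rule: rtrancl_induct)
    case base
    show ?case by (simp add: reach_def)
  next
    case (step c d)
    from step.hyps(2) have cd: "c \<in> P" "d \<in> P" "snd c \<le> int k" "snd d \<le> int k" "adjacent c d"
      by (auto simp: cell_step_def upper_def)
    have "fst c \<in> {0..<int b}" "fst d \<in> {0..<int b}" using cd P by (metis mem_Times_iff subsetD)+
    then obtain p q where pq: "fst c = int p" "fst d = int q" "p < b" "q < b"
      by (metis atLeastLessThan_iff nonneg_int_cases of_nat_less_iff)
    show ?case
    proof (cases "snd c = int k")
      case True
      then have c: "c = (int p, int k)" using pq by (metis prod.collapse)
      then have ip: "(i, p) \<in> (position_step x)\<^sup>*" using step.IH by (simp add: reach_def)
      have xp: "x ! p \<noteq> 0" using nz pq cd c by auto
      show ?thesis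
      proof (cases "snd d = int k")
        case True
        then have d: "d = (int q, int k)" using pq by (metis prod.collapse)
        then have "x ! q \<noteq> 0" using nz pq cd by auto
        then have "(p, q) \<in> position_step x"
          using xp pq cd(5) len c d by (auto simp: position_step_def adjacent_def)
        then show ?thesis using ip d by (auto simp: reach_def)
      next
        case False
        then have "d = (int p, int k - 1)"
          using cd(4,5) c by (cases d) (auto simp: adjacent_def)
        then show ?thesis using False ip xp pq cd by (auto simp: reach_def)
      qed
    next
      case False
      then obtain p' where p': "p' < b" "(i, p') \<in> (position_step x)\<^sup>*" "x ! p' \<noteq> 0"
        "(int p', int k - 1) \<in> P" "((int p', int k - 1), c) \<in> ?T"
        using step.IH by (auto simp: reach_def)
      show ?thesis
      proof (cases "snd d = int k")
        case True
        then have d: "d = (int q, int k)" using pq by (metis prod.collapse)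
        have c: "c = (int q, int k - 1)"
          using cd(3,5) False d by (cases c) (auto simp: adjacent_def)
        have xq: "x ! q \<noteq> 0" using nz pq cd d by auto
        \<comment> \<open>The excursion returns at \<open>q\<close>, and the cells above
          \<open>p'\<close> and \<open>q\<close> are connected in \<open>upper P k\<close>. Return
          to the starting position is split off because \<open>eq\<close> speaks of distinct
          positions.\<close>
        have "p' = q \<or> x ! p' = x ! q"
          using eq[of p' q] p' pq xq c cd by auto
        then have "(p', q) \<in> position_step x"
          using p' pq xq len by (auto simp: position_step_def)
        then show ?thesis using p'(2) d by (auto simp: reach_def)
      next
        case d: False
        then have "(c, d) \<in> cell_step (upper P k)"
          using cd False by (auto simp: cell_step_def upper_def)
        then have "((int p', int k - 1), d) \<in> ?T" using p'(5) by auto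
        then show ?thesis using p' d by (auto simp: reach_def)
      qed
    qed
  qed
  then show "(i, j) \<in> (position_step x)\<^sup>*" by (simp add: reach_def)
qed

section \<open>The run on a stack\<close>

definition row_word :: "nat \<Rightarrow> cell set \<Rightarrow> nat \<Rightarrow> word" where
  "row_word b P k = map (\<lambda>x. if (int x, int k) \<in> P then 1 else 0) [0..<b]"

lemma length_row_word [simp]: "length (row_word b P k) = b"
  by (simp add: row_word_def)

lemma nth_row_word [simp]: "i < b \<Longrightarrow> row_word b P k ! i = (if (int i, int k) \<in> P then 1 else 0)"
  by (simp add: row_word_def)

lemma stack_of_row_word: "stack_of b h P = map (row_word b P) [0..<h]"
  by (simp add: stack_of_def row_word_def)

lemma row_word_in_alphabet_iff: "row_word b P k \<in> alphabet b \<longleftrightarrow> (\<exists>i<b. (int i, int k) \<in> P)"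
proof -
  have "pos 1 (row_word b P k) = {i. i < b \<and> (int i, int k) \<in> P}"
    by (auto simp: pos_def split: if_splits)
  moreover have "set (row_word b P k) \<subseteq> {0, 1}" by (auto simp: row_word_def)
  ultimately show ?thesis by (auto simp: alphabet_def card_gt_0_iff)
qed

lemma run_append: "run b q (us @ vs) = Option.bind (run b q us) (\<lambda>q. run b q vs)"
  by (induction us arbitrary: q) (auto simp: Option.bind_assoc)

lemma run_stack_of_Suc:
  "run b q (stack_of b (Suc k) P) =
     Option.bind (run b q (stack_of b k P)) (\<lambda>q'. delta b q' (row_word b P k))"
proof -
  have [simp]: "Option.bind (delta b q' u) Some = delta b q' u" for q' u
    by (cases "delta b q' u") auto
  show ?thesis by (simp add: stack_of_row_word run_append)
qed

text \<open>The row above row 0 contains no cells, so that the invariant covers the initial state as well.\<close>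

definition tracks :: "nat \<Rightarrow> cell set \<Rightarrow> nat \<Rightarrow> state \<Rightarrow> bool" where
  "tracks b P k = (\<lambda>(v, l, r).
     (v, l, r) \<in> states b
     \<and> (\<forall>i<b. v ! i \<noteq> 0 \<longleftrightarrow> (int i, int k - 1) \<in> P)
     \<and> (\<forall>i<b. \<forall>j<b. v ! i \<noteq> 0 \<longrightarrow> v ! j \<noteq> 0 \<longrightarrow>
         (v ! i = v ! j \<longleftrightarrow> ((int i, int k - 1), (int j, int k - 1)) \<in> (cell_step (upper P k))\<^sup>*))
     \<and> (l \<longleftrightarrow> (\<exists>y<int k. (0, y) \<in> P)) \<and> (r \<longleftrightarrow> (\<exists>y<int k. (int b - 1, y) \<in> P))
     \<and> (\<forall>c\<in>upper P k. \<exists>i<b. (int i, int k - 1) \<in> P \<and> (c, (int i, int k - 1)) \<in> (cell_step (upper P k))\<^sup>*))"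

lemma tracksD:
  assumes "tracks b P k (v, l, r)"
  shows "(v, l, r) \<in> states b"
    and "\<And>i. i < b \<Longrightarrow> v ! i \<noteq> 0 \<longleftrightarrow> (int i, int k - 1) \<in> P"
    and "\<And>i j. i < b \<Longrightarrow> j < b \<Longrightarrow> v ! i \<noteq> 0 \<Longrightarrow> v ! j \<noteq> 0 \<Longrightarrow>
         v ! i = v ! j \<longleftrightarrow> ((int i, int k - 1), (int j, int k - 1)) \<in> (cell_step (upper P k))\<^sup>*"
    and "l \<longleftrightarrow> (\<exists>y<int k. (0, y) \<in> P)" and "r \<longleftrightarrow> (\<exists>y<int k. (int b - 1, y) \<in> P)"
    and "\<And>c. c \<in> upper P k \<Longrightarrow>
      \<exists>i<b. (int i, int k - 1) \<in> P \<and> (c, (int i, int k - 1)) \<in> (cell_step (upper P k))\<^sup>*"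
  using assms unfolding tracks_def prod.case by blast+

text \<open>\<open>triples\<close> constrains some representative \<open>w\<close>, while the state
  holds \<open>canon b w\<close>. Non-crossing depends only on the letter pattern and so passes to
  the canonical word.\<close>

lemma state_properties:
  assumes "(v, l, r) \<in> states b"
  shows "v \<in> words b" "length v = b" "non_crossing b v"
proof -
  obtain w where w: "v = canon b w" "(w, l, r) \<in> triples b" using assms by (auto simp: states_def)
  then have "w \<in> words b" "non_crossing b w" by (auto simp: triples_def)
  then show "v \<in> words b" "non_crossing b v"
    using w canon_properties(1) same_pattern_non_crossing[OF canon_same_pattern] by simp_all
  then show "length v = b" by (simp add: words_def)
qed

lemma tracks_initial:
  assumes "P \<subseteq> {0..<int b} \<times> {0..}" "b \<ge> 1"
  shows "tracks b P 0 (initial b)"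
proof -
  have neg: "(x, y) \<notin> P" if "y < 0" for x y
  proof
    assume "(x, y) \<in> P"
    then have "(x, y) \<in> {0..<int b} \<times> {0..}" using assms(1) by blast
    then show False using that by simp
  qed
  have "(replicate b 0, False, False) \<in> triples b"
    using assms(2)
    by (auto simp: triples_def words_def empty_row_def inscription_def separation_def non_crossing_def)
  then have "(canon b (replicate b 0), False, False) \<in> states b" unfolding states_def by blast
  then have "initial b \<in> states b" by (simp add: initial_def canon_replicate_0)
  moreover have "upper P 0 = {}" using neg by (auto simp: upper_def)
  ultimately show ?thesis
    unfolding tracks_def initial_def using neg by auto
qed

text \<open>After the vertical step two distinct selected positions share a letter iff the cells
  above them are occupied and connected, which is the hypothesis of
  \<open>position_step_iff_connected\<close>. The horizontal step then yields connectivity in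
  \<open>upper P (Suc k)\<close>, and passing to \<open>canon\<close> keeps the pattern.\<close>

lemma tracks_delta:
  assumes P: "P \<subseteq> {0..<int b} \<times> {0..}" and b: "b \<ge> 1" and q: "tracks b P k q"
    and d: "delta b q (row_word b P k) = Some q'"
  shows "tracks b P (Suc k) q'"
proof -
  let ?u = "row_word b P k"
  obtain v l r where q_eq: "q = (v, l, r)" by (cases q)
  let ?x = "vertical v ?u b"
  let ?w = "horizontal ?x"
  let ?l = "l \<or> ?u ! 0 = 1" and ?r = "r \<or> ?u ! (b - 1) = 1"
  let ?S = "(cell_step (upper P (Suc k)))\<^sup>*"
  note st = tracksD(1)[OF q[unfolded q_eq]] and row = tracksD(2)[OF q[unfolded q_eq]]
    and letters = tracksD(3)[OF q[unfolded q_eq]] and l = tracksD(4)[OF q[unfolded q_eq]]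
    and r = tracksD(5)[OF q[unfolded q_eq]] and down = tracksD(6)[OF q[unfolded q_eq]]
  have alpha: "?u \<in> alphabet b"
    and hit: "\<And>a. a \<noteq> 0 \<Longrightarrow> pos a v \<noteq> {} \<Longrightarrow> pos a v \<inter> pos 1 ?u \<noteq> {}"
    and q': "q' = (canon b ?w, ?l, ?r)"
    using d unfolding q_eq delta_def by (auto split: if_splits)
  have lenv: "length v = b" and ncv: "non_crossing b v" using state_properties[OF st] by auto
  have lenx: "length ?x = b" by simp
  have x0: "?x ! i \<noteq> 0 \<longleftrightarrow> (int i, int k) \<in> P" if "i < b" for i
    using vertical_eq_0_iff[OF that, of v ?u] that by simp
  have xeq: "?x ! i = ?x ! j \<longleftrightarrow> v ! i = v ! j \<and> v ! i \<noteq> 0"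
    if "i < b" "j < b" "i \<noteq> j" "?x ! i \<noteq> 0" "?x ! j \<noteq> 0" for i j
    using vertical_eq_iff[OF lenv that(1-3), of ?u] that vertical_eq_0_iff by metis
  have ncx: "non_crossing b ?x"
    unfolding non_crossing_def
  proof (intro allI impI, elim conjE)
    fix i k' j l'
    assume h: "i < k'" "k' < j" "j < l'" "l' < b" "?x ! i = ?x ! j" "?x ! j \<noteq> 0"
      "?x ! k' = ?x ! l'" "?x ! l' \<noteq> 0"
    \<comment> \<open>A fresh letter occurs only once, so both repeated letters are inherited from
      \<open>v\<close>, where non-crossing is known.\<close>
    have "v ! i = v ! j \<and> v ! i \<noteq> 0" "v ! k' = v ! l' \<and> v ! k' \<noteq> 0"
      using xeq[of i j] xeq[of k' l'] h by auto
    moreover from this have "v ! i = v ! k'"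
      using ncv[unfolded non_crossing_def, rule_format, of i k' j l'] h by auto
    ultimately show "?x ! i = ?x ! k'" using xeq[of i k'] h by auto
  qed
  have ww: "?w \<in> words b" using horizontal_in_words[of ?x] by simp
  have w0: "?w ! i \<noteq> 0 \<longleftrightarrow> (int i, int k) \<in> P" if "i < b" for i
    using horizontal_eq_0_iff[of i ?x] x0 that by simp
  have weq: "?w ! i = ?w ! j \<longleftrightarrow> ((int i, int k), (int j, int k)) \<in> ?S"
    if ij: "i < b" "j < b" "(int i, int k) \<in> P" "(int j, int k) \<in> P" for i j
  proof -
    have "?w ! i = ?w ! j \<longleftrightarrow> (i, j) \<in> (position_step ?x)\<^sup>*"
      using horizontal_eq_iff[of i ?x j] x0 ij by simp
    also have "\<dots> \<longleftrightarrow> ((int i, int k), (int j, int k)) \<in> ?S"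
    proof (rule position_step_iff_connected[OF P lenx x0])
      show "?x ! i' = ?x ! j' \<longleftrightarrow> (int i', int k - 1) \<in> P \<and> (int j', int k - 1) \<in> P \<and>
        ((int i', int k - 1), (int j', int k - 1)) \<in> (cell_step (upper P k))\<^sup>*"
        if "i' < b" "j' < b" "i' \<noteq> j'" "?x ! i' \<noteq> 0" "?x ! j' \<noteq> 0" for i' j'
        using xeq[OF that] row[OF that(1)] row[OF that(2)] letters[OF that(1,2)] by metis
    qed (use ij x0 in auto)
    finally show ?thesis .
  qed
  have triple: "(?w, ?l, ?r) \<in> triples b"
  proof -
    \<comment> \<open>A word of the alphabet contains a 1, so the new word is nonzero and the
      empty-row condition holds vacuously.\<close>
    obtain i where i: "i < b" "(int i, int k) \<in> P" using alpha row_word_in_alphabet_iff by blast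
    then have "?w \<noteq> replicate b 0" using w0[of i] by (metis nth_replicate)
    moreover have "inscription b (?w, ?l, ?r)"
      unfolding inscription_def using w0[of 0] w0[of "b - 1"] b by auto
    moreover have "separation b ?w" using separation_horizontal[of ?x] by simp
    moreover have "non_crossing b ?w" using non_crossing_horizontal[of ?x] ncx by simp
    ultimately show ?thesis using ww by (auto simp: triples_def empty_row_def)
  qed
  then have states: "(canon b ?w, ?l, ?r) \<in> states b" by (auto simp: states_def)
  have pat: "same_pattern b ?w (canon b ?w)" using ww by (rule canon_same_pattern)
  have less_Suc: "y < int (Suc k) \<longleftrightarrow> y < int k \<or> y = int k" for y by auto
  have l': "?l \<longleftrightarrow> (\<exists>y<int (Suc k). (0, y) \<in> P)" unfolding l less_Suc using b by auto
  have r': "?r \<longleftrightarrow> (\<exists>y<int (Suc k). (int b - 1, y) \<in> P)"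
    unfolding r less_Suc using b by (auto simp: of_nat_diff)
  have down': "\<exists>i<b. (int i, int k) \<in> P \<and> (c, (int i, int k)) \<in> ?S" if c: "c \<in> upper P (Suc k)" for c
  proof (cases "snd c = int k")
    case True
    have "c \<in> P" using c by (simp add: upper_def)
    then have "fst c \<in> {0..<int b}" using P by (metis mem_Times_iff subsetD)
    then have "nat (fst c) < b" "c = (int (nat (fst c)), int k)" using True by (auto simp: prod_eq_iff)
    then show ?thesis using \<open>c \<in> P\<close> by (metis rtrancl.rtrancl_refl)
  next
    case False
    then have "c \<in> upper P k" using c by (auto simp: upper_def)
    then obtain i where i: "i < b" "(int i, int k - 1) \<in> P"
      "(c, (int i, int k - 1)) \<in> (cell_step (upper P k))\<^sup>*" using down by blast
    have vi: "v ! i \<noteq> 0" using row i by blast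
    have "i \<in> pos (v ! i) v" using i lenv by (simp add: pos_def)
    \<comment> \<open>Definedness of the transition enters here: the component of \<open>c\<close>,
      represented by the letter \<open>v ! i\<close>, has a cell in row \<open>k - 1\<close> with a
      selected cell below it.\<close>
    then obtain j where "j \<in> pos (v ! i) v" "j \<in> pos 1 ?u" using hit[OF vi] by blast
    then have j: "j < b" "v ! j = v ! i" "(int j, int k) \<in> P"
      using lenv by (auto simp: pos_def split: if_splits)
    have pj: "(int j, int k - 1) \<in> P" using row[of j] j vi by auto
    have "((int i, int k - 1), (int j, int k - 1)) \<in> (cell_step (upper P k))\<^sup>*"
      using letters[of i j] i j vi by auto
    then have "(c, (int j, int k - 1)) \<in> ?S" using i(3) upper_Suc_mono by (meson rtrancl_trans)
    then have "(c, (int j, int k)) \<in> ?S"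
      using vertical_cell_step[OF pj j(3)] by (rule rtrancl.rtrancl_into_rtrancl)
    then show ?thesis using j by blast
  qed
  have row_eq: "int (Suc k) - 1 = int k" by simp
  show ?thesis
    unfolding tracks_def q' row_eq
    using states l' r' down' pat w0 weq unfolding same_pattern_def by (simp del: of_nat_Suc)
qed

lemma tracks_run:
  assumes "P \<subseteq> {0..<int b} \<times> {0..}" "b \<ge> 1"
  shows "run b (initial b) (stack_of b k P) = Some q \<Longrightarrow> tracks b P k q"
proof (induction k arbitrary: q)
  case 0
  then show ?case using tracks_initial[OF assms] by (simp add: stack_of_def)
next
  case (Suc k)
  then obtain q' where "run b (initial b) (stack_of b k P) = Some q'"
    "delta b q' (row_word b P k) = Some q"
    unfolding run_stack_of_Suc by (auto simp: bind_eq_Some_conv)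
  then show ?case using tracks_delta[OF assms] Suc.IH by blast
qed

section \<open>Inscribed polyominoes: the run never gets stuck\<close>

lemma inscribed_row_nonempty:
  assumes "P \<in> inscribed_polyominoes b h" "k < h"
  shows "\<exists>i<b. (int i, int k) \<in> P"
proof (rule ccontr)
  assume none: "\<not> ?thesis"
  have P: "P \<subseteq> {0..<int b} \<times> {0..<int h}" and conn: "edge_connected P"
    using assms by (auto simp: inscribed_polyominoes_def polyomino_def)
  obtain x x' where x: "(x, 0) \<in> P" and x': "(x', int h - 1) \<in> P"
    using assms by (auto simp: inscribed_polyominoes_def)
  have empty: "snd c \<noteq> int k" if "c \<in> P" for c
  proof
    assume "snd c = int k"
    moreover have "fst c \<in> {0..<int b}" using P that by (metis mem_Times_iff subsetD)
    ultimately have "nat (fst c) < b" "c = (int (nat (fst c)), int k)" by (auto simp: prod_eq_iff)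
    then show False using none that by metis
  qed
  have "((x, 0), (x', int h - 1)) \<in> (cell_step P)\<^sup>*"
    using conn x x' unfolding edge_connected_def cell_step_def by blast
  \<comment> \<open>The row changes by at most one per step, so a path starting in row 0 and
    avoiding row \<open>k\<close> stays above it. Its end in row \<open>h - 1\<close> contradicts
    \<open>k < h\<close>.\<close>
  then have "snd (x', int h - 1) < int k"
  proof (induction rule: rtrancl_induct)
    case base
    then show ?case using empty[OF x] by simp
  next
    case (step c d)
    have "snd d \<noteq> int k" "\<bar>snd c - snd d\<bar> \<le> 1"
      using step.hyps(2) empty[of d] by (auto simp: cell_step_def adjacent_def)
    then show ?case using step.IH by linarith
  qed
  then show False using assms(2) by simp
qed

text \<open>The first cell outside the upper part on a path leaving it lies below a cell of the
  component in which the path started.\<close>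

lemma path_leaves_upper:
  assumes "(c, d) \<in> (cell_step P)\<^sup>*" "snd c < int k" "\<not> snd d < int k"
  shows "\<exists>i. (i, int k) \<in> P \<and> (i, int k - 1) \<in> P \<and> (c, (i, int k - 1)) \<in> (cell_step (upper P k))\<^sup>*"
proof -
  have "?thesis \<or> snd d < int k \<and> (c, d) \<in> (cell_step (upper P k))\<^sup>*"
    using assms(1)
  proof (induction rule: rtrancl_induct)
    case base
    then show ?case using assms(2) by simp
  next
    case (step d e)
    show ?case
    proof (cases ?thesis)
      case False
      then have d: "snd d < int k" "(c, d) \<in> (cell_step (upper P k))\<^sup>*" using step.IH by auto
      have de: "d \<in> P" "e \<in> P" "adjacent d e" using step.hyps(2) by (auto simp: cell_step_def)
      show ?thesis
      proof (cases "snd e < int k")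
        case True
        then have "(d, e) \<in> cell_step (upper P k)" using d de by (auto simp: cell_step_def upper_def)
        then show ?thesis using d True by (meson rtrancl.rtrancl_into_rtrancl)
      next
        case False
        then have "d = (fst e, int k - 1)" "e = (fst e, int k)"
          using d(1) de(3) by (auto simp: adjacent_def prod_eq_iff)
        then show ?thesis using d de by metis
      qed
    qed simp
  qed
  then show ?thesis using assms(3) by blast
qed

text \<open>A transition can fail only on an empty row or when some letter has no selected cell
  below it. For the second, a cell with that letter is joined in \<open>P\<close> to a cell of row
  \<open>k\<close>; where the path first leaves \<open>upper P k\<close>, it descends from a cell of
  the same component, hence of the same letter.\<close>

lemma inscribed_run_defined:
  assumes P: "P \<in> inscribed_polyominoes b h" and b: "b \<ge> 1"
  shows "k \<le> h \<Longrightarrow> \<exists>q. run b (initial b) (stack_of b k P) = Some q"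
proof (induction k)
  case 0
  show ?case by (intro exI[of _ "initial b"]) (simp add: stack_of_def)
next
  case (Suc k)
  then obtain v l r where q: "run b (initial b) (stack_of b k P) = Some (v, l, r)"
    by (metis Suc_leD prod_cases3)
  have sub: "P \<subseteq> {0..<int b} \<times> {0..}" and conn: "edge_connected P"
    using P by (auto simp: inscribed_polyominoes_def polyomino_def)
  have t: "tracks b P k (v, l, r)" using tracks_run[OF sub b q] .
  then have st: "(v, l, r) \<in> states b" by (rule tracksD)
  have alpha: "row_word b P k \<in> alphabet b"
    using row_word_in_alphabet_iff inscribed_row_nonempty[OF P] Suc by auto
  then obtain i0 where i0: "i0 < b" "(int i0, int k) \<in> P" using row_word_in_alphabet_iff by blast
  have "pos a v \<inter> pos 1 (row_word b P k) \<noteq> {}" if a: "a \<noteq> 0" "pos a v \<noteq> {}" for a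
  proof -
    obtain i where i: "i < b" "v ! i = a" using a state_properties[OF st] by (auto simp: pos_def)
    then have c: "(int i, int k - 1) \<in> P" using tracksD(2)[OF t, of i] a by simp
    then have "((int i, int k - 1), (int i0, int k)) \<in> (cell_step P)\<^sup>*"
      using conn i0 unfolding edge_connected_def cell_step_def by blast
    from path_leaves_upper[OF this, of k] obtain y where
      y: "(y, int k) \<in> P" "(y, int k - 1) \<in> P"
        "((int i, int k - 1), (y, int k - 1)) \<in> (cell_step (upper P k))\<^sup>*" by auto
    have "y \<in> {0..<int b}" using y(1) sub by blast
    then obtain j where j: "y = int j" "j < b" by (metis atLeastLessThan_iff nat_0_le nat_less_iff)
    have "v ! j \<noteq> 0" using tracksD(2)[OF t] j y by simp
    then have "v ! j = a" using tracksD(3)[OF t, of i j] i j y a by simp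
    then have "j \<in> pos a v \<inter> pos 1 (row_word b P k)"
      using j y state_properties[OF st] by (auto simp: pos_def)
    then show ?thesis by blast
  qed
  then have "delta b (v, l, r) (row_word b P k) \<noteq> None" using st alpha by (simp add: delta_def)
  then show ?case unfolding run_stack_of_Suc q by auto
qed

text \<open>\<open>accepting\<close> asks for some representative over \<open>{0, 1}\<close>, which
  says nothing direct about the letters of the canonical word. Having a single nonzero letter is the
  renaming-invariant form that the invariant can supply.\<close>

lemma accepting_iff:
  "(v, l, r) \<in> accepting b \<longleftrightarrow> (v, l, r) \<in> states b \<and> l \<and> r \<and>
    (\<forall>i<b. \<forall>j<b. v ! i \<noteq> 0 \<longrightarrow> v ! j \<noteq> 0 \<longrightarrow> v ! i = v ! j)"
proof
  assume "(v, l, r) \<in> accepting b"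
  then obtain w where w: "v = canon b w" "(w, l, r) \<in> triples b" "set w \<subseteq> {0, 1}" "l" "r"
    by (auto simp: accepting_def)
  then have ww: "w \<in> words b" by (auto simp: triples_def)
  then have "same_pattern b w v" using w canon_same_pattern by simp
  moreover have "w ! i = 0 \<or> w ! i = 1" if "i < b" for i
    using w(3) nth_mem[of i w] that ww unfolding words_def by blast
  ultimately have "v ! i = v ! j" if "i < b" "j < b" "v ! i \<noteq> 0" "v ! j \<noteq> 0" for i j
    using that unfolding same_pattern_def by metis
  moreover have "(v, l, r) \<in> states b" using w by (auto simp: states_def)
  ultimately show "(v, l, r) \<in> states b \<and> l \<and> r \<and>
    (\<forall>i<b. \<forall>j<b. v ! i \<noteq> 0 \<longrightarrow> v ! j \<noteq> 0 \<longrightarrow> v ! i = v ! j)"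
    using w by blast
next
  assume h: "(v, l, r) \<in> states b \<and> l \<and> r \<and>
    (\<forall>i<b. \<forall>j<b. v ! i \<noteq> 0 \<longrightarrow> v ! j \<noteq> 0 \<longrightarrow> v ! i = v ! j)"
  then obtain w where w: "v = canon b w" "(w, l, r) \<in> triples b" by (auto simp: states_def)
  have ww: "w \<in> words b" and tw: "empty_row b (w, l, r)" "inscription b (w, l, r)"
    using w by (auto simp: triples_def)
  then have lenw: "length w = b" by (simp add: words_def)
  have pat: "same_pattern b w v" using ww w canon_same_pattern by simp
  \<comment> \<open>The empty row would force \<open>l\<close> to be false, but an accepting state
    has touched the left side.\<close>
  have "w \<noteq> replicate b 0" using tw h by (auto simp: empty_row_def)
  then obtain i where i: "i < b" "w ! i \<noteq> 0" using lenw by (metis length_replicate nth_equalityI nth_replicate)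
  define a where "a = w ! i"
  have all: "w ! j = 0 \<or> w ! j = a" if "j < b" for j
    using h pat i that unfolding a_def same_pattern_def by metis
  have a: "1 \<le> a" "a \<le> max_letter b"
    using i ww lenw nth_mem[of i w] unfolding a_def words_def by fastforce+
  \<comment> \<open>Exchanging the only nonzero letter \<open>a\<close> with 1 is a permutation of
    the letters, so \<open>w'\<close> is an equivalent representative over
    \<open>{0, 1}\<close>.\<close>
  define w' where "w' = map (transpose 1 a) w"
  have len': "length w' = b" using lenw by (simp add: w'_def)
  have w': "w' ! j = (if w ! j = 0 then 0 else 1)" if "j < b" for j
    using all[OF that] that lenw a by (auto simp: w'_def transpose_def)
  have "word_equiv b w w'"
    unfolding word_equiv_def
  proof (intro conjI exI ballI)
    show "pos 0 w = pos 0 w'" using w' lenw len' by (auto simp: pos_def split: if_splits)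
    show "transpose 1 a permutes {1..max_letter b}" using a by (intro permutes_swap_id) auto
    show "pos j w = pos (transpose 1 a j) w'" for j
      by (auto simp: pos_def w'_def dest: injD[OF inj_transpose])
  qed
  then have can: "canon b w' = v" using canon_cong w by metis
  have "\<forall>c\<in>set w'. c \<in> {0, 1}" unfolding all_set_conv_all_nth using w' len' by simp
  then have set': "set w' \<subseteq> {0, 1}" by blast
  have "w' \<in> words b" using set' len' a by (auto simp: words_def)
  moreover have "empty_row b (w', l, r)" using i w'[of i] by (auto simp: empty_row_def)
  moreover have "inscription b (w', l, r)" using h by (simp add: inscription_def)
  moreover have "separation b w'" using w' unfolding separation_def by auto
  moreover have "non_crossing b w'" using w' unfolding non_crossing_def by auto
  ultimately have "(w', l, r) \<in> triples b" by (simp add: triples_def)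
  then show "(v, l, r) \<in> accepting b" using can set' h by (auto simp: accepting_def)
qed

text \<open>Since \<open>upper P h = P\<close>, the invariant after the last row speaks of
  connectivity in \<open>P\<close> itself. If a single letter remains, any two cells are joined
  through the last row; conversely, connectedness of \<open>P\<close> makes all letters of the last
  row equal. The flags \<open>l\<close> and \<open>r\<close> give the two side columns, and nonempty
  words give the top and bottom rows.\<close>

lemma stack_of_accepted_iff:
  assumes b: "b \<ge> 1" and h: "h \<ge> 1" and P: "P \<subseteq> {0..<int b} \<times> {0..<int h}"
  shows "stack_of b h P \<in> accepted_stacks b h \<longleftrightarrow> P \<in> inscribed_polyominoes b h"
proof
  have P': "P \<subseteq> {0..<int b} \<times> {0..}" using P by auto
  have up: "upper P h = P" using P by (auto simp: upper_def)
  {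
    assume "stack_of b h P \<in> accepted_stacks b h"
    then obtain v l r where alpha: "set (stack_of b h P) \<subseteq> alphabet b"
      and q: "(v, l, r) \<in> accepting b" "run b (initial b) (stack_of b h P) = Some (v, l, r)"
      by (auto simp: accepted_stacks_def)
    have t: "tracks b P h (v, l, r)" using tracks_run[OF P' b q(2)] .
    have acc: "l" "r" "\<And>i j. i < b \<Longrightarrow> j < b \<Longrightarrow> v ! i \<noteq> 0 \<Longrightarrow> v ! j \<noteq> 0 \<Longrightarrow> v ! i = v ! j"
      using q(1) accepting_iff by auto
    have rows: "\<exists>i. (int i, int k) \<in> P" if "k < h" for k
    proof -
      have "row_word b P k \<in> alphabet b" using alpha that by (auto simp: stack_of_row_word)
      then show ?thesis using row_word_in_alphabet_iff by blast
    qed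
    have "edge_connected P"
      unfolding edge_connected_def cell_step_def[symmetric]
    proof (intro ballI)
      fix c d assume "c \<in> P" "d \<in> P"
      have down: "\<forall>c\<in>P. \<exists>i<b. (int i, int h - 1) \<in> P \<and> (c, (int i, int h - 1)) \<in> (cell_step P)\<^sup>*"
        using tracksD(6)[OF t] unfolding up by blast
      obtain i where i: "i < b" "(int i, int h - 1) \<in> P" "(c, (int i, int h - 1)) \<in> (cell_step P)\<^sup>*"
        using down \<open>c \<in> P\<close> by blast
      obtain j where j: "j < b" "(int j, int h - 1) \<in> P" "(d, (int j, int h - 1)) \<in> (cell_step P)\<^sup>*"
        using down \<open>d \<in> P\<close> by blast
      have "v ! i \<noteq> 0" "v ! j \<noteq> 0" using tracksD(2)[OF t] i j by simp_all
      then have "((int i, int h - 1), (int j, int h - 1)) \<in> (cell_step P)\<^sup>*"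
        using tracksD(3)[OF t, of i j] acc(3)[of i j] i(1) j(1) unfolding up by simp
      then show "(c, d) \<in> (cell_step P)\<^sup>*"
        using i(3) cell_step_converse[OF j(3)] by (meson rtrancl_trans)
    qed
    moreover have "finite P" using P by (rule finite_subset) auto
    moreover have "\<exists>y. (0, y) \<in> P" "\<exists>y. (int b - 1, y) \<in> P" using tracksD(4,5)[OF t] acc(1,2) by blast+
    moreover have "\<exists>x. (x, 0) \<in> P" using rows[of 0] h by auto
    moreover have "\<exists>x. (x, int h - 1) \<in> P" using rows[of "h - 1"] h by (auto simp: of_nat_diff)
    ultimately show "P \<in> inscribed_polyominoes b h"
      using P by (auto simp: inscribed_polyominoes_def polyomino_def)
  next
    assume ins: "P \<in> inscribed_polyominoes b h"
    obtain v l r where q: "run b (initial b) (stack_of b h P) = Some (v, l, r)"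
      using inscribed_run_defined[OF ins b, of h] by auto
    have t: "tracks b P h (v, l, r)" using tracks_run[OF P' b q] .
    have conn: "(c, d) \<in> (cell_step P)\<^sup>*" if "c \<in> P" "d \<in> P" for c d
      using ins that unfolding inscribed_polyominoes_def polyomino_def edge_connected_def cell_step_def
      by blast
    have "v ! i = v ! j" if "i < b" "j < b" "v ! i \<noteq> 0" "v ! j \<noteq> 0" for i j
      using tracksD(2,3)[OF t] that conn[of "(int i, int h - 1)" "(int j, int h - 1)"] unfolding up by blast
    moreover obtain y y' where y: "(0, y) \<in> P" "(int b - 1, y') \<in> P"
      using ins by (auto simp: inscribed_polyominoes_def)
    then have "y < int h" "y' < int h" using P by auto
    then have "l" "r" using tracksD(4,5)[OF t] y by blast+
    moreover have "(v, l, r) \<in> states b" using t by (rule tracksD)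
    ultimately have "(v, l, r) \<in> accepting b" using accepting_iff by blast
    moreover have "set (stack_of b h P) \<subseteq> alphabet b"
      using inscribed_row_nonempty[OF ins] row_word_in_alphabet_iff by (auto simp: stack_of_row_word)
    ultimately show "stack_of b h P \<in> accepted_stacks b h"
      using q by (auto simp: accepted_stacks_def stack_of_row_word)
  }
qed

section \<open>Stacks as an encoding of subsets of the rectangle\<close>

lemma stack_of_inject:
  assumes "P \<subseteq> {0..<int b} \<times> {0..<int h}" "Q \<subseteq> {0..<int b} \<times> {0..<int h}"
    "stack_of b h P = stack_of b h Q"
  shows "P = Q"
proof -
  have *: "(int x, int y) \<in> P \<longleftrightarrow> (int x, int y) \<in> Q" if "x < b" "y < h" for x y
  proof -
    have "stack_of b h P ! y ! x = stack_of b h Q ! y ! x" using assms(3) by simp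
    then show ?thesis using that by (simp add: stack_of_row_word split: if_splits)
  qed
  have "(a, c) \<in> P \<longleftrightarrow> (a, c) \<in> Q" for a c
  proof (cases "a \<in> {0..<int b} \<and> c \<in> {0..<int h}")
    case True
    then show ?thesis using *[of "nat a" "nat c"] by auto
  next
    case False
    then show ?thesis using assms(1,2) by blast
  qed
  then show ?thesis by auto
qed

lemma stack_of_surj:
  assumes "length us = h" "set us \<subseteq> alphabet b"
  shows "\<exists>P \<subseteq> {0..<int b} \<times> {0..<int h}. stack_of b h P = us"
proof (intro exI conjI)
  let ?P = "{(int x, int y) | x y. x < b \<and> y < h \<and> us ! y ! x = 1}"
  show "?P \<subseteq> {0..<int b} \<times> {0..<int h}" by auto
  show "stack_of b h ?P = us"
  proof (rule nth_equalityI)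
    show "length (stack_of b h ?P) = length us" using assms by (simp add: stack_of_row_word)
    fix y assume "y < length (stack_of b h ?P)"
    then have y: "y < h" by (simp add: stack_of_row_word)
    then have "us ! y \<in> alphabet b" using assms nth_mem by blast
    then have u: "length (us ! y) = b" "set (us ! y) \<subseteq> {0, 1}" by (auto simp: alphabet_def)
    have "row_word b ?P y = us ! y"
    proof (rule nth_equalityI)
      fix x assume "x < length (row_word b ?P y)"
      then have x: "x < b" by simp
      then have "us ! y ! x \<in> {0, 1}" using u nth_mem by blast
      then show "row_word b ?P y ! x = us ! y ! x" using x y by auto
    qed (simp add: u)
    then show "stack_of b h ?P ! y = us ! y" using y by (simp add: stack_of_row_word)
  qed
qed

theorem mainTheorem1:
  fixes b h :: nat
  assumes "b \<ge> 1" and "h \<ge> 1"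
  shows "bij_betw (stack_of b h) (inscribed_polyominoes b h) (accepted_stacks b h)"
proof (rule bij_betw_imageI)
  have sub: "P \<subseteq> {0..<int b} \<times> {0..<int h}" if "P \<in> inscribed_polyominoes b h" for P
    using that by (simp add: inscribed_polyominoes_def)
  show "inj_on (stack_of b h) (inscribed_polyominoes b h)"
    using sub by (intro inj_onI stack_of_inject)
  show "stack_of b h ` inscribed_polyominoes b h = accepted_stacks b h"
  proof (intro equalityI subsetI)
    fix us assume "us \<in> stack_of b h ` inscribed_polyominoes b h"
    then show "us \<in> accepted_stacks b h" using sub stack_of_accepted_iff[OF assms] by auto
  next
    fix us assume us: "us \<in> accepted_stacks b h"
    then obtain P where P: "P \<subseteq> {0..<int b} \<times> {0..<int h}" "stack_of b h P = us"
      using stack_of_surj[of us h b] by (auto simp: accepted_stacks_def)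
    then show "us \<in> stack_of b h ` inscribed_polyominoes b h"
      using us stack_of_accepted_iff[OF assms P(1)] by blast
  qed
qed

end
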